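(* Assume that $\mathcal{E}\neq 0$ and that $w=(w_1,\dots,w_m)$ is not constant in the element, i.e. not all of the vectors $w_1,\dots,w_m\in\mathbb{R}^n$ are scalar multiples of $\mathbf 1$. Define $$\mathfrak{r}_i=\alpha\left(w_i-\frac{\mathbf 1^T M w_i}{\mathbf 1^T M\mathbf 1}\,\mathbf 1\right),\quad i\in\{1,\dots,m\},\qquad \alpha=\frac{\mathcal{E}}{\sum_{k=1}^m\left(w_k^T M w_k-\frac{(\mathbf 1^T M w_k)^2}{\mathbf 1^T M\mathbf 1}\right)}.$$ Then $\mathfrak{r}=(\mathfrak{r}_1,\dots,\mathfrak{r}_m)\in(\mathbb{R}^n)^m$ is the unique solution of the minimization problem $$\min_{\mathfrak{r}\in(\mathbb{R}^n)^m}\ \frac12\|\mathfrak{r}\|_M^2\quad\text{subject to}\quad \mathbf 1^T M\mathfrak{r}_i=0\ \text{ for all } i\in\{1,\dots,m\},\qquad \sum_{i=1}^m w_i^T M\mathfrak{r}_i=\mathcal{E},$$ where $\|\mathfrak{r}\|_M^2=\sum_{i=1}^m\mathfrak{r}_i^T M\mathfrak{r}_i$. With this $\mathfrak{r}$, the corrected semidiscretization $\partial_t u_i=\mathrm{VOL}_i+\mathrm{SURF}_i+\mathfrak{r}_i$ satisfies the local conservation relation $$\mathbf 1^T M\,\partial_t u_i=-\sum_{j=1}^d\mathbf 1^T R^T B N_j f^{\mathrm{num},j}_i\quad\text{for all } i\in\{1,\dots,m\}$$ and the entropy conservation relation $$\sum_{i=1}^m w_i^T M\,\partial_t u_i=-\sum_{j=1}^d\mathbf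 1^T R^T B N_j F^{\mathrm{num},j}.$$
   Context: Consider a semidiscretization of a system of $m$ conservation laws in $d$ space dimensions with a convex entropy $U$ and entropy variables $w=\partial_u U(u)$, on one element with $n$ nodes and $n_b$ boundary nodes. All quantities are taken at a fixed time for a given numerical state. $u_i\in\mathbb{R}^n$ is the vector of nodal values of the $i$-th conserved variable, $w_i\in\mathbb{R}^n$ the vector of nodal values of the $i$-th component of the entropy variables, and $\mathbf 1$ denotes the vector all of whose entries are $1$. Operators: $M\in\mathbb{R}^{n\times n}$ is the mass matrix, symmetric positive definite and diagonal; $R\in\mathbb{R}^{n_b\times n}$ is the restriction/interpolation to the boundary nodes; $B\in\mathbb{R}^{n_b\times n_b}$ is the symmetric positive definite boundary mass matrix; $N_j\in\mathbb{R}^{n_b\times n_b}$, $j\in\{1,\dots,d\}$, represents multiplication of boundary values by the $j$-th component of the outer unit normal. The vectors $\mathrm{VOL}_i,\mathrm{SURF}_i\in\mathbb{R}^n$ are the volume and surface terms of a given baseline semidiscretization $\partial_t u_i=\mathrm{VOL}_i+\mathrm{SURF}_i$. The vectors $f^{\mathrm{num},j}_i\in\mathbb{R}^{n_b}$ contain the values at the boundary nodes of the numerical flux in direction $j$ for the $i$-th variable, and $F^{\mathrm{num},j}\in\mathbb{R}^{n_b}$ the values of the numerical entropy flux in direction $j$. The baseline semidiscretization is locally conservative: $\mathbf 1^T M(\mathrm{VOL}_i+\mathrm{SURF}_i)=-\sum_{j}\mathbf 1^T R^T B N_j f^{\mathrm{num},j}_i$ for every $i$. The real number $\mathcal{E}$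 is defined by $$\mathcal{E}=-\sum_{j=1}^d\mathbf 1^T R^T B N_j F^{\mathrm{num},j}-\sum_{k=1}^m w_k^T M\,\mathrm{VOL}_k-\sum_{k=1}^m w_k^T M\,\mathrm{SURF}_k.$$ *)

theory Defs
  imports "HOL-Analysis.Analysis"
begin

(* Throughout, 'n indexes the nodes, 'b the boundary nodes, 'm the conserved variables and
   'd the space directions.  A family (v_1, ..., v_m) of nodal vectors, i.e. an element of
   (R^n)^m, has type real^'n^'m, so that v $ i is the nodal vector of the i-th variable.
   The numeral 1 at type real^'n is the vector all of whose entries are 1, and x^T A y is
   written x \<bullet> (A *v y). *)

definition diagonal_matrix :: "real^'n^'n \<Rightarrow> bool" where
  "diagonal_matrix A \<longleftrightarrow> (\<forall>i j. i \<noteq> j \<longrightarrow> A $ i $ j = 0)"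

definition sym_pos_def :: "real^'n^'n \<Rightarrow> bool" where
  "sym_pos_def A \<longleftrightarrow> transpose A = A \<and> (\<forall>x. x \<noteq> 0 \<longrightarrow> 0 < x \<bullet> (A *v x))"

(* State at node k: from m vectors of length n to a single vector of length m. *)
definition nodal_value :: "real^'n^'m \<Rightarrow> 'n \<Rightarrow> real^'m" where
  "nodal_value v k = (\<chi> i. v $ i $ k)"

(* U is a differentiable convex function on an open set S of admissible states (convexity of S
   is part of convex_on), with gradient W: the entropy variables as a function of the state. *)
definition convex_entropy_with_variables ::
    "(real^'m) set \<Rightarrow> (real^'m \<Rightarrow> real) \<Rightarrow> (real^'m \<Rightarrow> real^'m) \<Rightarrow> bool" where
  "convex_entropy_with_variables S U W \<longleftrightarrow>
     open S \<and> convex_on S U \<and> (\<forall>x\<in>S. GDERIV U x :> W x)"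

(* Multiplication of boundary values by the j-th component of the unit normal field nu. *)
definition normal_matrix :: "('b \<Rightarrow> real^'d) \<Rightarrow> 'd \<Rightarrow> real^'b^'b" where
  "normal_matrix nu j = (\<chi> k l. if k = l then nu k $ j else 0)"

(* The sum over j of 1^T R^T B N_j g_j. *)
definition boundary_total ::
    "real^'n^'b \<Rightarrow> real^'b^'b \<Rightarrow> ('d::finite \<Rightarrow> real^'b^'b) \<Rightarrow> ('d \<Rightarrow> real^'b) \<Rightarrow> real" where
  "boundary_total R B N g =
     (\<Sum>j\<in>UNIV. (1::real^'n) \<bullet> (transpose R *v (B *v (N j *v g j))))"

definition M_norm_sq :: "real^'n^'n \<Rightarrow> real^'n^'m \<Rightarrow> real" where
  "M_norm_sq M r = (\<Sum>i\<in>UNIV. r $ i \<bullet> (M *v (r $ i)))"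

end

theory Submission
  imports Defs
begin

text \<open>
  Up to the factor \<open>\<alpha>\<close>, each \<open>r $ i\<close> is the \<open>M\<close>-orthogonal projection of \<open>w $ i\<close> onto the
  complement of the constants. Hence \<open>r\<close> is \<open>M\<close>-orthogonal to every difference of two feasible
  points, and Pythagoras gives \<open>\<parallel>s\<parallel>\<^sub>M\<^sup>2 = \<parallel>r\<parallel>\<^sub>M\<^sup>2 + \<parallel>s - r\<parallel>\<^sub>M\<^sup>2\<close> for every feasible \<open>s\<close>.
\<close>

lemma inner_matrix_vector_commute:
  fixes A :: "real^'n^'n"
  assumes "transpose A = A"
  shows "x \<bullet> (A *v y) = y \<bullet> (A *v x)"
  using dot_lmul_matrix[of x A y] transpose_matrix_vector[of A x] by (simp add: assms inner_commute)

lemmas matrix_form_simps =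
  matrix_vector_right_distrib matrix_vector_mult_diff_distrib matrix_vector_mult_scaleR
  inner_add_left inner_add_right inner_diff_left inner_diff_right

lemma sym_pos_def_nonneg: "sym_pos_def A \<Longrightarrow> 0 \<le> x \<bullet> (A *v x)"
  by (cases "x = 0") (auto simp: sym_pos_def_def intro: less_imp_le)

text \<open>A nonzero component contributes strictly and no other component subtracts. This is used
  twice: for strictness of the minimum, and for dividing by the denominator of
  \<open>\<alpha>\<close>.\<close>

lemma M_norm_sq_pos:
  assumes "sym_pos_def A" "s \<noteq> 0"
  shows "0 < M_norm_sq A s"
proof -
  obtain i where "s $ i \<noteq> 0"
    using assms(2) by (auto simp: vec_eq_iff)
  then have "0 < s $ i \<bullet> (A *v (s $ i))"
    using assms(1) by (simp add: sym_pos_def_def)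
  then show ?thesis
    unfolding M_norm_sq_def by (intro sum_pos2[of _ i]) (auto intro: sym_pos_def_nonneg[OF assms(1)])
qed

text \<open>Expanding along \<open>s = r + (s - r)\<close> yields two mixed terms per component.
  Symmetry of \<open>A\<close> merges them, and the orthogonality assumption cancels their
  sum.\<close>

lemma M_norm_sq_Pythagoras:
  assumes "transpose A = A" "(\<Sum>i\<in>UNIV. r $ i \<bullet> (A *v (s $ i - r $ i))) = 0"
  shows "M_norm_sq A s = M_norm_sq A r + M_norm_sq A (s - r)"
proof -
  have "s $ i \<bullet> (A *v (s $ i)) = r $ i \<bullet> (A *v (r $ i)) + (s - r) $ i \<bullet> (A *v ((s - r) $ i))
        + 2 * (r $ i \<bullet> (A *v (s $ i - r $ i)))" for i
    using inner_matrix_vector_commute[OF assms(1), of "s $ i" "r $ i"]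
    by (simp add: matrix_form_simps)
  then show ?thesis
    using assms(2) by (simp add: M_norm_sq_def sum.distrib flip: sum_distrib_left)
qed

text \<open>By Pythagoras, every feasible \<open>s\<close> other than \<open>r\<close> has strictly
  larger norm, which gives minimality and uniqueness at once. The constraints enter only through
  \<open>orth\<close>, so \<open>P\<close> stays abstract.\<close>

lemma is_arg_min_M_norm_sq_iff:
  assumes "sym_pos_def A" "P r"
    and orth: "\<And>s. P s \<Longrightarrow> (\<Sum>i\<in>UNIV. r $ i \<bullet> (A *v (s $ i - r $ i))) = 0"
  shows "is_arg_min (\<lambda>s. 1 / 2 * M_norm_sq A s) P s \<longleftrightarrow> s = r"
proof -
  have less: "M_norm_sq A r < M_norm_sq A s" if "P s" "s \<noteq> r" for s
    using M_norm_sq_Pythagoras[OF _ orth[OF that(1)]] M_norm_sq_pos[OF assms(1), of "s - r"]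
      assms(1) that(2) by (simp add: sym_pos_def_def)
  then show ?thesis
    unfolding is_arg_min_def
  proof (intro iffI conjI; (elim conjE)?)
    assume "P s" "\<nexists>y. P y \<and> 1 / 2 * M_norm_sq A y < 1 / 2 * M_norm_sq A s"
    then show "s = r"
      using less[of s] assms(2) by (metis mult_strict_left_mono half_gt_zero_iff zero_less_one)
  next
    assume "s = r"
    then show "P s" "\<nexists>y. P y \<and> 1 / 2 * M_norm_sq A y < 1 / 2 * M_norm_sq A s"
      using less assms(2) by (simp, metis less_asym mult_less_cancel_left_pos half_gt_zero_iff zero_less_one order.irrefl)
  qed
qed

text \<open>The subtracted coefficient is the weighted mean of the entries of \<open>x\<close>, with
  the column sums of \<open>A\<close> as weights.\<close>

definition mean_free :: "real^'n^'n \<Rightarrow> real^'n \<Rightarrow> real^'n" where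
  "mean_free A x = x - ((1 \<bullet> (A *v x)) / (1 \<bullet> (A *v 1))) *\<^sub>R 1"

lemma one_form_pos: "sym_pos_def A \<Longrightarrow> 0 < 1 \<bullet> (A *v (1 :: real^'n))"
  by (simp add: sym_pos_def_def vec_eq_iff)

lemma mean_free_orth:
  assumes "sym_pos_def A"
  shows "1 \<bullet> (A *v mean_free A x) = 0"
  using one_form_pos[OF assms] by (simp add: mean_free_def matrix_form_simps)

text \<open>The two vectors on the left differ by a multiple of \<open>1\<close>, to which
  \<open>y\<close> is orthogonal. This allows exchanging \<open>w $ i\<close> and its projection
  wherever the other argument is mean free.\<close>

lemma inner_mean_free:
  assumes "1 \<bullet> (A *v y) = 0"
  shows "mean_free A x \<bullet> (A *v y) = x \<bullet> (A *v y)"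
  using assms by (simp add: mean_free_def matrix_form_simps)

text \<open>The right-hand side is the form of the summands in the denominator of
  \<open>\<alpha>\<close>.\<close>

lemma mean_free_form:
  assumes "sym_pos_def A"
  shows "x \<bullet> (A *v mean_free A x) = x \<bullet> (A *v x) - (1 \<bullet> (A *v x))\<^sup>2 / (1 \<bullet> (A *v 1))"
proof -
  have "x \<bullet> (A *v 1) = 1 \<bullet> (A *v x)"
    using assms by (intro inner_matrix_vector_commute) (simp add: sym_pos_def_def)
  then show ?thesis
    by (simp add: mean_free_def matrix_form_simps power2_eq_square)
qed

theorem theorem2p8:
  fixes M :: "real^'n^'n"
    and R :: "real^'n^'b"
    and B :: "real^'b^'b"
    and nu :: "'b \<Rightarrow> real^'d"
    and N :: "'d \<Rightarrow> real^'b^'b"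
    and S :: "(real^'m) set"
    and U :: "real^'m \<Rightarrow> real"
    and W :: "real^'m \<Rightarrow> real^'m"
    and u w VOL SURF r :: "real^'n^'m"
    and fnum :: "'d \<Rightarrow> 'm \<Rightarrow> real^'b"
    and Fnum :: "'d \<Rightarrow> real^'b"
    and \<E> \<alpha> :: real
  assumes M: "sym_pos_def M" "diagonal_matrix M"
    and B: "sym_pos_def B"
    and nu: "\<And>k. norm (nu k) = 1"
    and N: "\<And>j. N j = normal_matrix nu j"
    and entropy: "convex_entropy_with_variables S U W"
    and u: "\<And>k. nodal_value u k \<in> S"
    and w: "\<And>k. nodal_value w k = W (nodal_value u k)"
    and baseline_conservative:
      "\<And>i. 1 \<bullet> (M *v (VOL $ i + SURF $ i)) = - boundary_total R B N (\<lambda>j. fnum j i)"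
    and \<E>_def: "\<E> = - boundary_total R B N Fnum
                     - (\<Sum>k\<in>UNIV. w $ k \<bullet> (M *v (VOL $ k)))
                     - (\<Sum>k\<in>UNIV. w $ k \<bullet> (M *v (SURF $ k)))"
    and \<E>_nonzero: "\<E> \<noteq> 0"
    and w_not_constant: "\<not> (\<forall>i. \<exists>c::real. w $ i = c *\<^sub>R 1)"
    and \<alpha>_def: "\<alpha> = \<E> / (\<Sum>k\<in>UNIV. w $ k \<bullet> (M *v (w $ k))
                               - (1 \<bullet> (M *v (w $ k)))\<^sup>2 / (1 \<bullet> (M *v 1)))"
    and r_def: "\<And>i. r $ i = \<alpha> *\<^sub>R (w $ i - ((1 \<bullet> (M *v (w $ i))) / (1 \<bullet> (M *v 1))) *\<^sub>R 1)"
  shows "(\<forall>s. is_arg_min (\<lambda>s::real^'n^'m. 1 / 2 * M_norm_sq M s)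
                (\<lambda>s. (\<forall>i. 1 \<bullet> (M *v (s $ i)) = 0) \<and> (\<Sum>i\<in>UNIV. w $ i \<bullet> (M *v (s $ i))) = \<E>) s
              \<longleftrightarrow> s = r) \<and>
         (\<forall>(v :: real \<Rightarrow> real^'n^'m) t.
            v t = u \<and>
            (\<forall>i. ((\<lambda>\<tau>. v \<tau> $ i) has_vector_derivative (VOL $ i + SURF $ i + r $ i)) (at t)) \<longrightarrow>
            (\<forall>i. 1 \<bullet> (M *v vector_derivative (\<lambda>\<tau>. v \<tau> $ i) (at t))
                 = - boundary_total R B N (\<lambda>j. fnum j i)) \<and>
            (\<Sum>i\<in>UNIV. w $ i \<bullet> (M *v vector_derivative (\<lambda>\<tau>. v \<tau> $ i) (at t)))
                 = - boundary_total R B N Fnum)"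
proof -
  define z where "z = (\<chi> i. mean_free M (w $ i))"
  have r: "r $ i = \<alpha> *\<^sub>R z $ i" for i
    by (simp add: r_def z_def mean_free_def)
  have z_orth: "1 \<bullet> (M *v (z $ i)) = 0" for i
    by (simp add: z_def mean_free_orth[OF M(1)])
  have r_orth: "1 \<bullet> (M *v (r $ i)) = 0" for i
    by (simp add: r matrix_form_simps z_orth)
  have z_form: "(\<Sum>i\<in>UNIV. w $ i \<bullet> (M *v (z $ i))) = M_norm_sq M z"
    unfolding M_norm_sq_def using inner_mean_free[OF z_orth] by (simp add: z_def)
  \<comment> \<open>A vanishing projection would make each \<open>w $ i\<close> a multiple of
    \<open>1\<close>.\<close>
  have "z \<noteq> 0"
  proof
    assume "z = 0"
    then have "mean_free M (w $ i) = 0" for i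
      by (metis z_def vec_lambda_beta zero_index)
    then show False
      using w_not_constant unfolding mean_free_def by (metis right_minus_eq)
  qed
  then have z_pos: "0 < M_norm_sq M z"
    by (rule M_norm_sq_pos[OF M(1)])
  have "\<alpha> = \<E> / M_norm_sq M z"
    unfolding \<alpha>_def z_form[symmetric] by (simp add: z_def mean_free_form[OF M(1)])
  \<comment> \<open>The factor \<open>\<alpha>\<close> is thus exactly the scaling of
    \<open>z\<close> that meets the entropy constraint.\<close>
  then have "\<alpha> * M_norm_sq M z = \<E>"
    using z_pos by simp
  then have r_entropy: "(\<Sum>i\<in>UNIV. w $ i \<bullet> (M *v (r $ i))) = \<E>"
    using z_form by (simp add: r matrix_form_simps flip: sum_distrib_left)
  let ?P = "\<lambda>s. (\<forall>i. 1 \<bullet> (M *v (s $ i)) = 0) \<and> (\<Sum>i\<in>UNIV. w $ i \<bullet> (M *v (s $ i))) = \<E>"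
  have "(\<Sum>i\<in>UNIV. r $ i \<bullet> (M *v (s $ i - r $ i))) = 0" if "?P s" for s :: "real^'n^'m"
  proof -
    \<comment> \<open>Since \<open>s $ i - r $ i\<close> is mean free, \<open>z $ i\<close> may be
      replaced by \<open>w $ i\<close>. After summation both terms on the right equal
      \<open>\<E>\<close> by the entropy constraint, so they cancel.\<close>
    have "r $ i \<bullet> (M *v (s $ i - r $ i)) = \<alpha> * (w $ i \<bullet> (M *v (s $ i)) - w $ i \<bullet> (M *v (r $ i)))" for i
    proof -
      have "1 \<bullet> (M *v (s $ i - r $ i)) = 0"
        using that r_orth[of i] by (simp add: matrix_form_simps)
      from inner_mean_free[OF this, of "w $ i"]
      have "z $ i \<bullet> (M *v (s $ i - r $ i)) = w $ i \<bullet> (M *v (s $ i)) - w $ i \<bullet> (M *v (r $ i))"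
        by (simp add: z_def matrix_vector_mult_diff_distrib inner_diff_right)
      then show ?thesis
        by (metis r inner_scaleR_left)
    qed
    then show ?thesis
      using that r_entropy by (simp add: sum_subtractf flip: sum_distrib_left)
  qed
  then have "is_arg_min (\<lambda>s. 1 / 2 * M_norm_sq M s) ?P s \<longleftrightarrow> s = r" for s
    using r_orth r_entropy by (intro is_arg_min_M_norm_sq_iff[OF M(1)]) auto
  moreover have "1 \<bullet> (M *v (VOL $ i + SURF $ i + r $ i)) = - boundary_total R B N (\<lambda>j. fnum j i)" for i
    using baseline_conservative[of i] r_orth[of i]
    by (simp add: matrix_vector_right_distrib inner_add_right)
  \<comment> \<open>The correction contributes \<open>\<E>\<close>, whose volume and surface parts
    cancel those of the baseline and leave the boundary term.\<close>
  moreover have "(\<Sum>i\<in>UNIV. w $ i \<bullet> (M *v (VOL $ i + SURF $ i + r $ i))) = - boundary_total R B N Fnum"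
    using \<E>_def r_entropy by (simp add: matrix_vector_right_distrib inner_add_right sum.distrib)
  moreover have "vector_derivative (\<lambda>\<tau>. v \<tau> $ i) (at t) = VOL $ i + SURF $ i + r $ i"
    if "\<forall>i. ((\<lambda>\<tau>. v \<tau> $ i) has_vector_derivative (VOL $ i + SURF $ i + r $ i)) (at t)"
    for v :: "real \<Rightarrow> real^'n^'m" and t i
    using that by (intro vector_derivative_at) simp
  ultimately show ?thesis
    by simp
qed

end
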